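(* Let $\rho=(r_n)_n$ be an increasing sequence in $[0,1)$ with $r_n\to1$ as $n\to\infty$, and let $f\in\mathcal{U}_A(\mathbb{D},\rho)$. (1) The function $e^f$ is Abel universal. In particular, there exist zero-free Abel universal functions. (2) If $f$ is zero-free, then for every $\alpha\in\mathbb{C}$, $\alpha+1/f$ is an Abel universal function. As a consequence, for every $\alpha\in\mathbb{C}$, there exists a function in $\mathcal{U}_A(\mathbb{D},\rho)$ that has $\alpha$ as an asymptotic value.
   Context: $\mathbb{D}$ is the open unit disc, $\mathbb{T}=\partial\mathbb{D}$ the unit circle, and $H(\mathbb{D})$ the space of holomorphic functions on $\mathbb{D}$. For an increasing sequence $\rho=(r_n)_n$ in $[0,1)$ with $r_n\to1$, $\mathcal{U}_A(\mathbb{D},\rho)$ denotes the set of all $f\in H(\mathbb{D})$ such that: for any compact subset $K\subset\mathbb{T}$, $K\neq\mathbb{T}$, and any continuous function $\varphi:K\to\mathbb{C}$, there exists an increasing sequence $(n_k)_k$ in $\mathbb{N}$ such that $\sup_{\zeta\in K}|f(r_{n_k}\zeta)-\varphi(\zeta)|\to0$ as $k\to\infty$. A function is called Abel universal if it belongs to $\mathcal{U}_A(\mathbb{D})=\bigcup_{\rho}\mathcal{U}_A(\mathbb{D},\rho)$, the union over all such sequences $\rho$. A value $\alpha\in\mathbb{C}\cup\{\infty\}$ is an asymptotic value of $f\in H(\mathbb{D})$ if there exists a path (continuous map) $\gamma:[0,1)\to\mathbb{D}$ with $|\gamma(t)|\to1$ as $t\to1$ such that $f(\gamma(t))\to\alpha$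 as $t\to1$. *)

theory Defs
  imports "HOL-Complex_Analysis.Complex_Analysis"
begin

text \<open>Holomorphic functions on the unit disc are represented by total functions that are
  holomorphic on \<^term>\<open>ball (0::complex) 1\<close>; their values outside the disc play no role.
  ``Increasing'' is read non-strictly for radii. Merging repeated radii shows that the
  union over all strictly increasing sequences is the same class.\<close>

definition radius_seq :: "(nat \<Rightarrow> real) \<Rightarrow> bool" where
  "radius_seq r \<longleftrightarrow> incseq r \<and> (\<forall>n. r n \<in> {0..<1}) \<and> r \<longlonglongrightarrow> 1"

text \<open>Convergence of the suprema to 0 is uniform convergence on \<open>K\<close>; unlike a real-valued
  \<open>SUP\<close>, \<^const>\<open>uniform_limit\<close> is also meaningful for empty \<open>K\<close>.\<close>

definition abel_universal_wrt :: "(nat \<Rightarrow> real) \<Rightarrow> (complex \<Rightarrow> complex) set" where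
  "abel_universal_wrt r = {f. f holomorphic_on ball 0 1 \<and>
     (\<forall>K \<phi>. compact K \<and> K \<subseteq> sphere 0 1 \<and> K \<noteq> sphere 0 1 \<and> continuous_on K \<phi> \<longrightarrow>
       (\<exists>n :: nat \<Rightarrow> nat. strict_mono n \<and>
         uniform_limit K (\<lambda>k \<zeta>. f (of_real (r (n k)) * \<zeta>)) \<phi> sequentially))}"

definition abel_universal :: "(complex \<Rightarrow> complex) set" where
  "abel_universal = (\<Union>r \<in> {r. radius_seq r}. abel_universal_wrt r)"

text \<open>An element of the Riemann sphere is encoded as a \<^typ>\<open>complex option\<close>, where
  \<^const>\<open>None\<close> stands for \<open>\<infinity>\<close>.\<close>

definition asymptotic_value :: "(complex \<Rightarrow> complex) \<Rightarrow> complex option \<Rightarrow> bool" where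
  "asymptotic_value f \<alpha> \<longleftrightarrow> (\<exists>\<gamma> :: real \<Rightarrow> complex.
     continuous_on {0..<1} \<gamma> \<and> \<gamma> ` {0..<1} \<subseteq> ball 0 1 \<and>
     ((\<lambda>t. norm (\<gamma> t)) \<longlongrightarrow> 1) (at_left 1) \<and>
     filterlim (\<lambda>t. f (\<gamma> t)) (case \<alpha> of Some a \<Rightarrow> nhds a | None \<Rightarrow> at_infinity) (at_left 1))"

end

theory Submission
  imports Defs "HOL-Real_Asymp.Real_Asymp"
begin

text \<open>Functions of the form \<open>exp g\<close> are dense in \<open>C(K)\<close>, which makes universality pass from \<open>f\<close> to
  \<open>exp f\<close> and, for zero-free \<open>f\<close>, to \<open>\<alpha> + 1 / f\<close>. For the asymptotic value \<open>\<alpha>\<close>, every universal function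
  is unbounded on each component of each set \<open>\<bar>f\<bar> > R\<close> and hence has the asymptotic value \<open>\<infinity>\<close>;
  apply this to \<open>exp f\<close> and take \<open>\<alpha> + 1 / exp f\<close>.\<close>

section \<open>Universality without subsequences\<close>

text \<open>Indices can be picked one at a time, so a convergent subsequence amounts to good
  approximations at arbitrarily late indices. This form is easier to verify and to apply.\<close>

lemma abel_universal_wrt_iff:
  "f \<in> abel_universal_wrt r \<longleftrightarrow> f holomorphic_on ball 0 1 \<and>
     (\<forall>K \<phi>. compact K \<and> K \<subseteq> sphere 0 1 \<and> K \<noteq> sphere 0 1 \<and> continuous_on K \<phi> \<longrightarrow>
       (\<forall>e>0. \<forall>N. \<exists>n\<ge>N. \<forall>\<zeta>\<in>K. dist (f (of_real (r n) * \<zeta>)) (\<phi> \<zeta>) < e))"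
proof -
  have "(\<exists>n :: nat \<Rightarrow> nat. strict_mono n \<and>
         uniform_limit K (\<lambda>k \<zeta>. f (of_real (r (n k)) * \<zeta>)) \<phi> sequentially) \<longleftrightarrow>
       (\<forall>e>0. \<forall>N. \<exists>n\<ge>N. \<forall>\<zeta>\<in>K. dist (f (of_real (r n) * \<zeta>)) (\<phi> \<zeta>) < e)"
    (is "?L \<longleftrightarrow> ?R") for K and \<phi> :: "complex \<Rightarrow> complex"
  proof
    assume ?L
    then obtain n :: "nat \<Rightarrow> nat" where n: "strict_mono n"
      and lim: "uniform_limit K (\<lambda>k \<zeta>. f (of_real (r (n k)) * \<zeta>)) \<phi> sequentially"
      by blast
    show ?R
    proof (intro allI impI)
      fix e :: real and N :: nat
      assume "e > 0"
      with lim obtain M where M: "\<And>k. k \<ge> M \<Longrightarrow> \<forall>\<zeta>\<in>K. dist (f (of_real (r (n k)) * \<zeta>)) (\<phi> \<zeta>) < e"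
        unfolding uniform_limit_iff eventually_sequentially by blast
      have "n (max M N) \<ge> N"
        using seq_suble[OF n, of "max M N"] by simp
      then show "\<exists>n\<ge>N. \<forall>\<zeta>\<in>K. dist (f (of_real (r n) * \<zeta>)) (\<phi> \<zeta>) < e"
        using M[of "max M N"] by auto
    qed
  next
    assume R: ?R
    \<comment> \<open>The tolerance for the \<open>k\<close>-th choice tends to 0, so strictly
      increasing choices satisfying \<open>P k\<close> give a uniformly convergent
      subsequence.\<close>
    define P where "P k n \<longleftrightarrow> (\<forall>\<zeta>\<in>K. dist (f (of_real (r n) * \<zeta>)) (\<phi> \<zeta>) < inverse (real (Suc k)))" for k n
    have ex: "\<exists>n\<ge>N. P k n" for k N
      unfolding P_def using R by simp
    have "\<exists>n. \<forall>k. P k (n k) \<and> n k < n (Suc k)"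
      by (rule dependent_nat_choice) (use ex in \<open>meson Suc_le_eq\<close>)+
    then obtain n where n: "\<And>k. P k (n k)" "\<And>k. n k < n (Suc k)"
      by blast
    have "uniform_limit K (\<lambda>k \<zeta>. f (of_real (r (n k)) * \<zeta>)) \<phi> sequentially"
      unfolding uniform_limit_iff
    proof (intro allI impI)
      fix e :: real
      assume "e > 0"
      then have "\<forall>\<^sub>F k in sequentially. inverse (real (Suc k)) < e"
        by (rule order_tendstoD(2)[OF LIMSEQ_inverse_real_of_nat])
      then show "\<forall>\<^sub>F k in sequentially. \<forall>\<zeta>\<in>K. dist (f (of_real (r (n k)) * \<zeta>)) (\<phi> \<zeta>) < e"
        by eventually_elim (use n(1) P_def in \<open>meson less_trans\<close>)
    qed
    then show ?L
      using n(2) by (auto simp: strict_mono_Suc_iff)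
  qed
  then show ?thesis
    unfolding abel_universal_wrt_def by simp
qed

lemma abel_universal_wrtD:
  assumes "f \<in> abel_universal_wrt r"
    and "compact K" "K \<subseteq> sphere 0 1" "K \<noteq> sphere 0 1" "continuous_on K \<phi>" "e > 0"
  obtains n where "n \<ge> N" "\<And>\<zeta>. \<zeta> \<in> K \<Longrightarrow> dist (f (of_real (r n) * \<zeta>)) (\<phi> \<zeta>) < e"
  using assms unfolding abel_universal_wrt_iff by meson

section \<open>Approximation by exponentials on the circle\<close>

text \<open>A proper compact subset of the circle lives on the real line via the angle, and a
  polynomial curve in the plane has negligible image, hence misses some value near 0.\<close>

lemma exp_approximation_on_circle:
  fixes \<phi> :: "complex \<Rightarrow> complex"
  assumes K: "compact K" "K \<subseteq> sphere 0 1" "K \<noteq> sphere 0 1"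
    and \<phi>: "continuous_on K \<phi>" and e: "e > 0"
  obtains g where "continuous_on K g" "\<And>\<zeta>. \<zeta> \<in> K \<Longrightarrow> dist (exp (g \<zeta>)) (\<phi> \<zeta>) < e"
proof -
  obtain \<omega> where \<omega>: "norm \<omega> = 1" "\<omega> \<notin> K"
    using K by (metis mem_sphere_0 subsetI subset_antisym)
  \<comment> \<open>Multiplication by \<open>- 1 / \<omega>\<close> moves the omitted point
    \<open>\<omega>\<close> to -1, on the branch cut of \<open>Ln\<close>, so the angle
    \<open>\<theta>\<close> is continuous on \<open>K\<close>; \<open>\<tau>\<close> recovers a
    point from its angle.\<close>
  define \<theta> where "\<theta> \<zeta> = Im (Ln (- \<zeta> / \<omega>))" for \<zeta>
  define \<tau> where "\<tau> t = - \<omega> * cis t" for t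
  have \<omega>0: "\<omega> \<noteq> 0" using \<omega>(1) by auto
  have nonpos: "- \<zeta> / \<omega> \<notin> \<real>\<^sub>\<le>\<^sub>0" if "\<zeta> \<in> K" for \<zeta>
  proof
    assume "- \<zeta> / \<omega> \<in> \<real>\<^sub>\<le>\<^sub>0"
    then obtain x where x: "- \<zeta> / \<omega> = of_real x" "x \<le> 0"
      by (rule nonpos_Reals_cases)
    have "norm (- \<zeta> / \<omega>) = 1"
      using that K(2) \<omega>(1) by (auto simp: norm_divide)
    then have "x = -1"
      using x by (metis abs_of_nonpos minus_minus norm_of_real)
    then have "\<zeta> = \<omega>"
      using x(1) \<omega>0 by (simp add: field_simps)
    with that \<omega>(2) show False by simp
  qed
  have \<theta>_cont: "continuous_on K \<theta>"
    unfolding \<theta>_def by (intro continuous_intros nonpos) (use \<omega>0 in auto)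
  have \<tau>\<theta>: "\<tau> (\<theta> \<zeta>) = \<zeta>" if "\<zeta> \<in> K" for \<zeta>
  proof -
    have "norm (- \<zeta> / \<omega>) = 1"
      using that K(2) \<omega>(1) by (auto simp: norm_divide)
    moreover from this have nz: "- \<zeta> / \<omega> \<noteq> 0"
      by (metis norm_zero zero_neq_one)
    ultimately have "Re (Ln (- \<zeta> / \<omega>)) = 0"
      by simp
    then have "cis (\<theta> \<zeta>) = exp (Ln (- \<zeta> / \<omega>))"
      by (simp add: exp_eq_polar \<theta>_def)
    with nz have "cis (\<theta> \<zeta>) = - \<zeta> / \<omega>"
      by simp
    then show ?thesis
      using \<omega>0 by (simp add: \<tau>_def)
  qed
  have "continuous_on (\<theta> ` K) (\<phi> \<circ> \<tau>)"
  proof (rule continuous_on_compose)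
    show "continuous_on (\<theta> ` K) \<tau>"
      unfolding \<tau>_def by (intro continuous_intros)
    have "\<tau> ` \<theta> ` K = K"
      using \<tau>\<theta> by force
    then show "continuous_on (\<tau> ` \<theta> ` K) \<phi>"
      using \<phi> by simp
  qed
  moreover have "compact (\<theta> ` K)"
    using \<theta>_cont K(1) by (rule compact_continuous_image)
  ultimately obtain p :: "real \<Rightarrow> complex" where p: "polynomial_function p"
    and p_approx: "\<And>t. t \<in> \<theta> ` K \<Longrightarrow> norm ((\<phi> \<circ> \<tau>) t - p t) < e / 2"
    using Stone_Weierstrass_polynomial_function[of "\<theta> ` K" "\<phi> \<circ> \<tau>" "e / 2"] e by auto
  have "p differentiable_on UNIV"
    using p by (simp add: differentiable_on_polynomial_function)
  then have "negligible (range p)"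
    by (intro negligible_differentiable_image_lowdim) auto
  then have "\<not> ball 0 (e / 2) \<subseteq> range p"
    using e negligible_subset open_not_negligible[of "ball (0::complex) (e / 2)"] by auto
  \<comment> \<open>The polynomial uses half of the tolerance, the shift by \<open>c\<close> the
    other half. The shifted curve \<open>p t - c\<close> avoids 0, hence has a continuous logarithm
    on the line.\<close>
  then obtain c where c: "norm c < e / 2" "c \<notin> range p"
    by (metis mem_ball_0 subsetI)
  have "continuous_on UNIV (\<lambda>t. p t - c)"
    using p by (intro continuous_intros continuous_on_polymonial_function)
  moreover have "contractible (UNIV :: real set)"
    by (simp add: convex_imp_contractible)
  ultimately obtain L where L: "continuous_on UNIV L" "\<And>t. p t - c = exp (L t)"
    by (rule continuous_logarithm_on_contractible) (use c(2) in auto)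
  show thesis
  proof
    show "continuous_on K (L \<circ> \<theta>)"
      using \<theta>_cont L(1) by (meson continuous_on_compose continuous_on_subset top_greatest)
    fix \<zeta> assume \<zeta>: "\<zeta> \<in> K"
    have "dist (exp ((L \<circ> \<theta>) \<zeta>)) (\<phi> \<zeta>) = norm ((\<phi> \<zeta> - p (\<theta> \<zeta>)) + c)"
      by (simp add: dist_norm norm_minus_commute algebra_simps flip: L(2))
    also have "\<dots> \<le> norm (\<phi> \<zeta> - p (\<theta> \<zeta>)) + norm c"
      by (rule norm_triangle_ineq)
    also have "\<dots> < e"
      using p_approx[of "\<theta> \<zeta>"] \<zeta> c(1) by (simp add: \<tau>\<theta>)
    finally show "dist (exp ((L \<circ> \<theta>) \<zeta>)) (\<phi> \<zeta>) < e" .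
  qed
qed

section \<open>Transfer of universality under composition\<close>

lemma abel_universal_wrt_compose:
  assumes f: "f \<in> abel_universal_wrt r"
    and S: "open S" "F holomorphic_on S" "f ` ball 0 1 \<subseteq> S"
    and approx: "\<And>K (\<phi> :: complex \<Rightarrow> complex) e. \<lbrakk>compact K; K \<subseteq> sphere 0 1; K \<noteq> sphere 0 1; continuous_on K \<phi>; e > 0\<rbrakk>
      \<Longrightarrow> \<exists>g. continuous_on K g \<and> g ` K \<subseteq> S \<and> (\<forall>\<zeta>\<in>K. dist (F (g \<zeta>)) (\<phi> \<zeta>) < e)"
  shows "(\<lambda>z. F (f z)) \<in> abel_universal_wrt r"
  unfolding abel_universal_wrt_iff
proof (intro conjI allI impI)
  have "f holomorphic_on ball 0 1"
    using f by (simp add: abel_universal_wrt_def)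
  then show "(\<lambda>z. F (f z)) holomorphic_on ball 0 1"
    using holomorphic_on_compose_gen[OF _ S(2,3)] by (simp add: o_def)
next
  fix K :: "complex set" and \<phi> :: "complex \<Rightarrow> complex" and e :: real and N :: nat
  assume K: "compact K \<and> K \<subseteq> sphere 0 1 \<and> K \<noteq> sphere 0 1 \<and> continuous_on K \<phi>" and e: "e > 0"
  show "\<exists>n\<ge>N. \<forall>\<zeta>\<in>K. dist (F (f (of_real (r n) * \<zeta>))) (\<phi> \<zeta>) < e"
  proof (cases "K = {}")
    case False
    obtain g where g: "continuous_on K g" "g ` K \<subseteq> S" "\<And>\<zeta>. \<zeta> \<in> K \<Longrightarrow> dist (F (g \<zeta>)) (\<phi> \<zeta>) < e / 2"
      using approx[of K \<phi> "e / 2"] K e by auto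
    have cgK: "compact (g ` K)"
      using g(1) K by (simp add: compact_continuous_image)
    obtain d where d: "d > 0" "{x. infdist x (g ` K) \<le> d} \<subseteq> S"
      using compact_in_open_separated[of "g ` K" S] cgK S(1) g(2) False by auto
    let ?C = "{x. infdist x (g ` K) \<le> d}"
    have "compact ?C"
      using False cgK d(1) by (intro compact_infdist_le) auto
    then have "uniformly_continuous_on ?C F"
      using S(2) d(2) by (meson compact_uniformly_continuous continuous_on_subset holomorphic_on_imp_continuous_on)
    then obtain d' where d': "d' > 0"
      "\<And>x y. x \<in> ?C \<Longrightarrow> y \<in> ?C \<Longrightarrow> dist y x < d' \<Longrightarrow> dist (F y) (F x) < e / 2"
      unfolding uniformly_continuous_on_def using e by (meson half_gt_zero)
    \<comment> \<open>The bound \<open>d\<close> keeps the values of \<open>f\<close> inside the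
      compact thickening \<open>?C\<close>, and \<open>d'\<close> then limits the change of
      \<open>F\<close> to \<open>e / 2\<close>.\<close>
    obtain n where n: "n \<ge> N" "\<And>\<zeta>. \<zeta> \<in> K \<Longrightarrow> dist (f (of_real (r n) * \<zeta>)) (g \<zeta>) < min d d'"
      using abel_universal_wrtD[OF f, of K g "min d d'" N] K g(1) d(1) d'(1) by auto
    have "dist (F (f (of_real (r n) * \<zeta>))) (\<phi> \<zeta>) < e" if \<zeta>: "\<zeta> \<in> K" for \<zeta>
    proof -
      have "g \<zeta> \<in> ?C"
        using \<zeta> d(1) by simp
      moreover have "f (of_real (r n) * \<zeta>) \<in> ?C"
        using infdist_le[of "g \<zeta>" "g ` K" "f (of_real (r n) * \<zeta>)"] \<zeta> n(2)[OF \<zeta>] by simp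
      ultimately have "dist (F (f (of_real (r n) * \<zeta>))) (F (g \<zeta>)) < e / 2"
        using d'(2) n(2)[OF \<zeta>] by simp
      with g(3)[OF \<zeta>] show ?thesis
        by (metis dist_triangle_half_r dist_commute)
    qed
    with n(1) show ?thesis by blast
  qed auto
qed

lemma abel_universal_wrt_exp:
  assumes "f \<in> abel_universal_wrt r"
  shows "(\<lambda>z. exp (f z)) \<in> abel_universal_wrt r"
proof (rule abel_universal_wrt_compose[where S = UNIV and F = exp, OF assms])
  fix K and \<phi> :: "complex \<Rightarrow> complex" and e :: real
  assume "compact K" "K \<subseteq> sphere 0 1" "K \<noteq> sphere 0 1" "continuous_on K \<phi>" "e > 0"
  then show "\<exists>g. continuous_on K g \<and> g ` K \<subseteq> UNIV \<and> (\<forall>\<zeta>\<in>K. dist (exp (g \<zeta>)) (\<phi> \<zeta>) < e)"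
    by (metis exp_approximation_on_circle subset_UNIV)
qed (auto intro!: holomorphic_intros)

text \<open>Reciprocals of exponentials are again exponentials, so approximating
  \<open>\<phi> - \<alpha>\<close> by \<open>exp g\<close> and using \<open>exp (- g)\<close> as
  intermediate target suffices.\<close>

lemma abel_universal_wrt_reciprocal:
  assumes f: "f \<in> abel_universal_wrt r"
    and nz: "\<And>z. z \<in> ball 0 1 \<Longrightarrow> f z \<noteq> 0"
  shows "(\<lambda>z. \<alpha> + 1 / f z) \<in> abel_universal_wrt r"
proof (rule abel_universal_wrt_compose[where S = "- {0}" and F = "\<lambda>w. \<alpha> + 1 / w", OF f])
  fix K and \<phi> :: "complex \<Rightarrow> complex" and e :: real
  assume K: "compact K" "K \<subseteq> sphere 0 1" "K \<noteq> sphere 0 1" and \<phi>: "continuous_on K \<phi>" and e: "e > 0"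
  have "continuous_on K (\<lambda>\<zeta>. \<phi> \<zeta> - \<alpha>)"
    using \<phi> by (intro continuous_intros)
  then obtain g where g: "continuous_on K g" "\<And>\<zeta>. \<zeta> \<in> K \<Longrightarrow> dist (exp (g \<zeta>)) (\<phi> \<zeta> - \<alpha>) < e"
    using exp_approximation_on_circle[OF K _ e] by metis
  show "\<exists>g. continuous_on K g \<and> g ` K \<subseteq> - {0} \<and> (\<forall>\<zeta>\<in>K. dist (\<alpha> + 1 / g \<zeta>) (\<phi> \<zeta>) < e)"
  proof (intro exI conjI)
    show "continuous_on K (\<lambda>\<zeta>. exp (- g \<zeta>))"
      using g(1) by (intro continuous_intros)
    show "\<forall>\<zeta>\<in>K. dist (\<alpha> + 1 / exp (- g \<zeta>)) (\<phi> \<zeta>) < e"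
      using g(2) by (simp add: exp_minus field_simps dist_norm)
  qed auto
qed (use nz in \<open>auto intro!: holomorphic_intros\<close>)

section \<open>Growth on components of superlevel sets\<close>

text \<open>Phragmen--Lindelof argument: \<open>f\<close> is small on circles \<open>\<bar>z\<bar> = r n\<close> off an arc shrinking to 1,
  so if \<open>f\<close> were bounded on a component of \<open>\<bar>f\<bar> > R\<close>, the maximum principle for
  \<open>f z ^ p * (1 - z) / 2\<close> would give \<open>\<bar>f z\<bar> ^ p * \<bar>1 - z\<bar> / 2 \<le> R ^ p\<close> there for every \<open>p\<close>.\<close>

lemma abel_universal_wrt_unbounded_on_component:
  assumes r: "radius_seq r" and f: "f \<in> abel_universal_wrt r"
    and z: "z \<in> ball 0 1" and R: "R > 0" "norm (f z) > R"
  obtains w where "path_component {w \<in> ball 0 1. norm (f w) > R} z w" "norm (f w) > M"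
proof (rule ccontr)
  define A where "A = {w \<in> ball 0 1. norm (f w) > R}"
  define \<Omega> where "\<Omega> = connected_component_set A z"
  have hol: "f holomorphic_on ball 0 1"
    using f by (simp add: abel_universal_wrt_def)
  then have cont: "continuous_on (ball 0 1) f"
    by (rule holomorphic_on_imp_continuous_on)
  have "A = ball 0 1 \<inter> (\<lambda>w. norm (f w)) -` {R<..}"
    by (auto simp: A_def)
  then have opA: "open A"
    using cont by (metis continuous_on_norm continuous_open_preimage open_ball open_greaterThan)
  have op\<Omega>: "open \<Omega>"
    unfolding \<Omega>_def using opA by (rule open_connected_component)
  have z\<Omega>: "z \<in> \<Omega>"
    unfolding \<Omega>_def using z R by (simp add: A_def)
  note witness = that
  assume "\<not> thesis"
  moreover have "\<Omega> = path_component_set A z"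
    unfolding \<Omega>_def using opA by (simp add: open_path_connected_component_set)
  ultimately have bnd: "norm (f w) \<le> M" if "w \<in> \<Omega>" for w
    using that witness[of w] by (force simp: A_def)
  \<comment> \<open>A boundary point of \<open>\<Omega>\<close> in the disc with a value above
    \<open>R\<close> would have an open component of \<open>A\<close> around it; this would meet
    \<open>\<Omega>\<close>, hence equal it.\<close>
  have front: "norm (f w) \<le> R" if "w \<in> closure \<Omega>" "w \<notin> \<Omega>" "w \<in> ball 0 1" for w
  proof (rule ccontr)
    assume "\<not> norm (f w) \<le> R"
    then have wA: "w \<in> A"
      using that by (simp add: A_def)
    define V where "V = connected_component_set A w"
    have "open V" "w \<in> V"
      unfolding V_def using opA wA by (auto intro: open_connected_component)
    then have "V \<inter> \<Omega> \<noteq> {}"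
      using that(1) by (metis closure_iff_nhds_not_empty Int_commute subset_refl)
    then have "V = \<Omega>"
      unfolding V_def \<Omega>_def by (metis connected_component_nonoverlap)
    with \<open>w \<in> V\<close> that(2) show False by simp
  qed
  have key: "norm (f z) ^ p * (norm (1 - z) / 2) \<le> R ^ p" for p
  proof -
    \<comment> \<open>The size of \<open>d\<close> lets the assumed bound \<open>M\<close> be
      absorbed near 1, where \<open>f\<close> is not controlled:
      \<open>\<bar>M\<bar> ^ p * d \<le> R ^ p\<close>. Adding 1 keeps the denominator
      positive.\<close>
    define d where "d = R ^ p / (\<bar>M\<bar> ^ p + 1)"
    have d: "d > 0" "\<bar>M\<bar> ^ p * d \<le> R ^ p"
      using R unfolding d_def by (auto simp: field_simps add_pos_nonneg add_nonneg_pos intro!: divide_pos_pos)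
    \<comment> \<open>Removing an arc around 1 makes \<open>K\<close> a proper subset of the circle,
      so universality with target 0 gives values below \<open>R\<close> on \<open>r n\<close> times
      \<open>K\<close>.\<close>
    define K where "K = {\<zeta> \<in> sphere (0::complex) 1. d \<le> dist \<zeta> 1}"
    have "K = sphere 0 1 \<inter> {\<zeta>. d \<le> dist \<zeta> 1}"
      by (auto simp: K_def)
    moreover have "compact (sphere (0::complex) 1)"
      by simp
    moreover have "closed {\<zeta>::complex. d \<le> dist \<zeta> 1}"
      by (intro closed_Collect_le continuous_intros)
    ultimately have "compact K"
      by (simp only: compact_Int_closed)
    have "1 \<in> sphere 0 1 - K"
      using d(1) by (simp add: K_def)
    then have "K \<noteq> sphere 0 1"
      by blast
    have "K \<subseteq> sphere 0 1"
      by (auto simp: K_def)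
    have "\<forall>\<^sub>F n in sequentially. r n > max (norm z) (1 - d)"
      using r z d(1) by (intro order_tendstoD(1)[of _ 1]) (auto simp: radius_seq_def)
    then obtain N where N: "\<And>n. n \<ge> N \<Longrightarrow> r n > max (norm z) (1 - d)"
      by (auto simp: eventually_sequentially)
    obtain n where n: "n \<ge> N" "\<And>\<zeta>. \<zeta> \<in> K \<Longrightarrow> dist (f (of_real (r n) * \<zeta>)) 0 < R"
      using abel_universal_wrtD[OF f \<open>compact K\<close> \<open>K \<subseteq> sphere 0 1\<close> \<open>K \<noteq> sphere 0 1\<close>
          continuous_on_const R(1)] by metis
    have rn: "r n < 1" "r n > norm z" "r n > 1 - d" "r n > 0"
      using r N[OF n(1)] norm_ge_zero[of z] by (auto simp: radius_seq_def simp del: norm_ge_zero)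
    \<comment> \<open>Cutting at radius \<open>r n\<close> keeps the closure inside the open disc,
      so the maximum principle applies.\<close>
    define U where "U = \<Omega> \<inter> ball 0 (r n)"
    have opU: "open U"
      using op\<Omega> by (simp add: U_def open_Int)
    have clU: "closure U \<subseteq> closure \<Omega> \<inter> cball 0 (r n)"
      unfolding U_def
      by (intro Int_greatest closure_mono closure_minimal) (auto intro: less_imp_le)
    then have clU1: "closure U \<subseteq> ball 0 1"
      using rn(1) by fastforce
    let ?g = "\<lambda>w. f w ^ p * ((1 - w) / 2)"
    have "norm (?g z) \<le> R ^ p"
    proof (rule maximum_modulus_frontier[where f = ?g and S = U])
      show "?g holomorphic_on interior U"
        using clU1 opU closure_subset[of U] hol
        by (auto intro!: holomorphic_intros simp: interior_open intro: holomorphic_on_subset)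
      show "continuous_on (closure U) ?g"
        using continuous_on_subset[OF cont clU1] by (intro continuous_intros) auto
      show "bounded U"
        by (simp add: U_def bounded_Int)
      show "z \<in> U"
        using z\<Omega> rn(2) by (simp add: U_def)
      fix w assume w: "w \<in> frontier U"
      then have w1: "w \<in> closure \<Omega>" "norm w \<le> r n" "w \<in> ball 0 1" "w \<notin> U"
        using clU clU1 opU by (auto simp: frontier_def interior_open)
      have le1: "norm (1 - w) / 2 \<le> 1"
        using norm_triangle_ineq4[of 1 w] w1 by simp
      show "norm (?g w) \<le> R ^ p"
      proof (cases "norm (f w) \<le> R")
        case True
        have "norm (?g w) = norm (f w) ^ p * (norm (1 - w) / 2)"
          by (simp add: norm_mult norm_power norm_divide)
        also have "\<dots> \<le> R ^ p * 1"
          using True le1 R(1) by (intro mult_mono power_mono) auto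
        finally show ?thesis by simp
      next
        case False
        \<comment> \<open>By \<open>front\<close>, such a \<open>w\<close> lies in
          \<open>\<Omega>\<close>, hence on the cutting circle. Its projection
          \<open>\<zeta>\<close> to the unit circle falls in the removed arc, so
          \<open>norm (1 - w) < d + (1 - r n) < 2 * d\<close>.\<close>
        then have w\<Omega>: "w \<in> \<Omega>"
          using front w1 by blast
        then have wr: "norm w = r n"
          using w1 by (auto simp: U_def)
        define \<zeta> where "\<zeta> = w / of_real (r n)"
        have w\<zeta>: "w = of_real (r n) * \<zeta>" "norm \<zeta> = 1"
          using rn(4) wr by (auto simp: \<zeta>_def norm_divide)
        have "\<zeta> \<notin> K"
          using n(2)[of \<zeta>] False by (auto simp: w\<zeta>(1))
        then have "norm (1 - \<zeta>) < d"
          using w\<zeta>(2) by (simp add: K_def dist_norm norm_minus_commute)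
        moreover have "norm (\<zeta> - w) = 1 - r n"
        proof -
          have "\<zeta> - w = of_real (1 - r n) * \<zeta>"
            by (simp add: w\<zeta>(1) algebra_simps)
          then show ?thesis
            using rn(1) w\<zeta>(2) by (simp add: norm_mult del: of_real_diff)
        qed
        ultimately have "norm (1 - w) / 2 \<le> d"
          using norm_triangle_ineq[of "1 - \<zeta>" "\<zeta> - w"] rn(3) by simp
        moreover have "norm (f w) \<le> \<bar>M\<bar>"
          using bnd[OF w\<Omega>] by simp
        moreover have "norm (?g w) = norm (f w) ^ p * (norm (1 - w) / 2)"
          by (simp add: norm_mult norm_power norm_divide)
        ultimately have "norm (?g w) \<le> \<bar>M\<bar> ^ p * d"
          by (simp only:) (intro mult_mono power_mono, auto)
        with d(2) show ?thesis by simp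
      qed
    qed
    then show ?thesis
      by (simp add: norm_mult norm_power norm_divide)
  qed
  have z1: "norm (1 - z) / 2 > 0"
    using z by auto
  have "norm (f z) / R > 1"
    using R by simp
  \<comment> \<open>The factor \<open>norm (1 - z) / 2\<close> is fixed and positive, so a large
    power of the ratio outweighs it.\<close>
  then obtain p where "(norm (f z) / R) ^ p > 1 / (norm (1 - z) / 2)"
    using real_arch_pow by blast
  then have "norm (f z) ^ p * (norm (1 - z) / 2) > R ^ p"
    using R(1) z1 by (simp add: field_simps power_divide)
  with key[of p] show False by simp
qed

section \<open>Gluing infinitely many paths\<close>

text \<open>Finitely many closed intervals paste directly; continuity at a point then depends only
  on a bounded initial segment.\<close>

lemma continuous_on_atLeast_0_glue:
  fixes g :: "real \<Rightarrow> 'a::topological_space"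
  assumes "\<And>n. continuous_on {real n..real (Suc n)} g"
  shows "continuous_on {0..} g"
proof -
  have init: "continuous_on {0..real n} g" for n
  proof (induction n)
    case (Suc n)
    have "{0..real (Suc n)} = {0..real n} \<union> {real n..real (Suc n)}"
      by auto
    with Suc assms[of n] show ?case
      by (metis closed_real_atLeastAtMost continuous_on_closed_Un)
  qed auto
  show ?thesis
    unfolding continuous_on_eq_continuous_within
  proof
    fix x :: real assume x: "x \<in> {0..}"
    obtain n where n: "x < real n"
      using reals_Archimedean2 by blast
    then have "continuous (at x within {0..real n}) g"
      using init[of n] x by (simp add: continuous_on_eq_continuous_within)
    moreover have "at x within {0..} = at x within {0..real n}"
      by (rule at_within_nhd[of _ "{..<real n}"]) (use n in auto)
    ultimately show "continuous (at x within {0..}) g"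
      by (simp add: continuous_within)
  qed
qed

text \<open>The \<open>n\<close>-th connecting path is run during the time interval from
  \<open>n\<close> to \<open>n + 1\<close>. This supplies the infinite path of Iversen's
  construction.\<close>

lemma glued_path_through_sequence:
  fixes z :: "nat \<Rightarrow> 'a::topological_space"
  assumes "\<And>n. path_component (A n) (z n) (z (Suc n))"
  shows "\<exists>\<Gamma> :: real \<Rightarrow> 'a. continuous_on {0..} \<Gamma> \<and> (\<forall>s\<ge>0. \<Gamma> s \<in> A (nat \<lfloor>s\<rfloor>))"
proof -
  obtain g where g: "\<And>n. path (g n)" "\<And>n. path_image (g n) \<subseteq> A n"
    "\<And>n. g n 0 = z n" "\<And>n. g n 1 = z (Suc n)"
    using assms unfolding path_component_def pathstart_def pathfinish_def by metis
  define \<Gamma> where "\<Gamma> s = g (nat \<lfloor>s\<rfloor>) (s - of_int \<lfloor>s\<rfloor>)" for s :: real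
  \<comment> \<open>At the right endpoint the floor jumps to \<open>n + 1\<close> and
    \<open>\<Gamma>\<close> already follows \<open>g (Suc n)\<close>; both paths pass through
    \<open>z (Suc n)\<close> there.\<close>
  have eq: "\<Gamma> s = g n (s - real n)" if s: "s \<in> {real n..real (Suc n)}" for n s
  proof (cases "s = real (Suc n)")
    case True
    then have "\<lfloor>s\<rfloor> = int (Suc n)"
      by linarith
    then show ?thesis
      using True g(3)[of "Suc n"] g(4)[of n] by (simp add: \<Gamma>_def nat_add_distrib)
  next
    case False
    with s have "\<lfloor>s\<rfloor> = int n"
      by (auto simp: floor_eq_iff)
    then show ?thesis
      by (simp add: \<Gamma>_def)
  qed
  show ?thesis
  proof (intro exI conjI)
    show "continuous_on {0..} \<Gamma>"
    proof (rule continuous_on_atLeast_0_glue)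
      fix n
      have "continuous_on {real n..real (Suc n)} (g n \<circ> (\<lambda>s. s - real n))"
      proof (rule continuous_on_compose)
        show "continuous_on {real n..real (Suc n)} (\<lambda>s. s - real n)"
          by (intro continuous_intros)
        show "continuous_on ((\<lambda>s. s - real n) ` {real n..real (Suc n)}) (g n)"
          by (rule continuous_on_subset[OF g(1)[of n, unfolded path_def]]) auto
      qed
      then show "continuous_on {real n..real (Suc n)} \<Gamma>"
        by (rule continuous_on_eq) (simp add: eq)
    qed
    have "s - of_int \<lfloor>s\<rfloor> \<in> {0..1}" for s :: real
      by (simp; linarith)
    then show "\<forall>s\<ge>0. \<Gamma> s \<in> A (nat \<lfloor>s\<rfloor>)"
      using g(2) unfolding \<Gamma>_def path_image_def by blast
  qed
qed

section \<open>Asymptotic values\<close>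

text \<open>Iversen's construction of a path along which \<open>f\<close> exceeds the level \<open>n + 1\<close> on its \<open>n\<close>-th piece.\<close>

lemma abel_universal_wrt_asymptotic_value_infinity:
  assumes r: "radius_seq r" and f: "f \<in> abel_universal_wrt r"
  shows "asymptotic_value f None"
proof -
  define A where "A n = {w \<in> ball 0 1. norm (f w) > real (Suc n)}" for n
  have cont: "continuous_on (ball 0 1) f"
    using f by (auto simp: abel_universal_wrt_def intro: holomorphic_on_imp_continuous_on)
  have "\<exists>z. \<forall>n. z n \<in> A n \<and> path_component (A n) (z n) (z (Suc n))"
  proof (rule dependent_nat_choice)
    have "(-1::complex) \<in> sphere 0 1 - {1}"
      by simp
    then have "{1::complex} \<noteq> sphere 0 1"
      by blast
    \<comment> \<open>Approximating the constant 2 within 1 at the single point 1 yields a starting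
      point above level 1.\<close>
    then obtain n where "dist (f (of_real (r n) * 1)) 2 < 1"
      using abel_universal_wrtD[OF f, of "{1}" "\<lambda>_. 2" 1 0] by auto
    then have "norm (f (of_real (r n))) > 1"
      using norm_triangle_ineq2[of 2 "2 - f (of_real (r n))"] by (simp add: dist_norm norm_minus_commute)
    moreover have "\<bar>r n\<bar> < 1"
      using r by (force simp: radius_seq_def abs_less_iff intro: less_le_trans[of "-1" 0])
    ultimately have "of_real (r n) \<in> A 0"
      by (simp add: A_def)
    then show "\<exists>z. z \<in> A 0"
      by blast
  next
    fix z n assume "z \<in> A n"
    \<comment> \<open>The path stays above level \<open>n + 1\<close> while its endpoint exceeds
      \<open>n + 2\<close>, so the endpoint can start the next piece.\<close>
    then obtain w where "path_component (A n) z w" "norm (f w) > real (Suc (Suc n))"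
      using abel_universal_wrt_unbounded_on_component[OF r f, of z "real (Suc n)"]
      unfolding A_def by (metis (no_types, lifting) mem_Collect_eq of_nat_0_less_iff zero_less_Suc)
    then show "\<exists>w. w \<in> A (Suc n) \<and> path_component (A n) z w"
      using path_component_mem(2)[of "A n" z w] by (auto simp: A_def)
  qed
  then obtain z where "\<And>n. path_component (A n) (z n) (z (Suc n))"
    by blast
  from glued_path_through_sequence[of A z, OF this]
  obtain \<Gamma> :: "real \<Rightarrow> complex"
    where \<Gamma>: "continuous_on {0..} \<Gamma>" "\<forall>s\<ge>0. \<Gamma> s \<in> A (nat \<lfloor>s\<rfloor>)"
    by blast
  have ball: "\<Gamma> s \<in> ball 0 1" if "s \<ge> 0" for s
    using \<Gamma>(2) that by (simp add: A_def)
  have large: "norm (f (\<Gamma> s)) > s" if "s \<ge> 0" for s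
  proof -
    have "real (Suc (nat \<lfloor>s\<rfloor>)) > s"
      using that by linarith
    moreover have "\<Gamma> s \<in> A (nat \<lfloor>s\<rfloor>)"
      using \<Gamma>(2) that by blast
    ultimately show ?thesis
      by (simp add: A_def)
  qed
  have lim_f: "filterlim (\<lambda>s. f (\<Gamma> s)) at_infinity at_top"
  proof (rule filterlim_norm_at_top_imp_at_infinity)
    have "\<forall>\<^sub>F s in at_top. s \<le> norm (f (\<Gamma> s))"
      using eventually_ge_at_top[of 0] by eventually_elim (use large in force)
    then show "filterlim (\<lambda>s. norm (f (\<Gamma> s))) at_top at_top"
      by (rule filterlim_at_top_mono[OF filterlim_ident])
  qed
  have lim_\<Gamma>: "((\<lambda>s. norm (\<Gamma> s)) \<longlongrightarrow> 1) at_top"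
  proof (rule order_tendstoI)
    fix c :: real assume c: "c < 1"
    \<comment> \<open>Since \<open>f\<close> is bounded on smaller closed discs, growth along
      \<open>\<Gamma>\<close> forces the path to leave each of them for good.\<close>
    have "compact (f ` cball 0 c)"
      using c by (intro compact_continuous_image continuous_on_subset[OF cont]) auto
    then obtain B where B: "\<And>w. w \<in> cball 0 c \<Longrightarrow> norm (f w) \<le> B"
      using compact_imp_bounded bounded_iff by (metis imageI)
    show "\<forall>\<^sub>F s in at_top. c < norm (\<Gamma> s)"
      using eventually_ge_at_top[of "max 0 B"]
    proof eventually_elim
      case (elim s)
      then show ?case
        using B[of "\<Gamma> s"] large[of s] by (force simp: not_le)
    qed
  next
    fix c :: real assume "1 < c"
    show "\<forall>\<^sub>F s in at_top. norm (\<Gamma> s) < c"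
      using eventually_ge_at_top[of 0]
      by eventually_elim (use ball \<open>1 < c\<close> in fastforce)
  qed
  \<comment> \<open>This substitution transfers the path from the half-line to the parameter
    interval from 0 to 1.\<close>
  have time: "filterlim (\<lambda>t::real. t / (1 - t)) at_top (at_left 1)"
    by real_asymp
  show ?thesis
    unfolding asymptotic_value_def
  proof (intro exI[of _ "\<lambda>t. \<Gamma> (t / (1 - t))"] conjI)
    show "continuous_on {0..<1} (\<lambda>t. \<Gamma> (t / (1 - t)))"
      by (rule continuous_on_compose2[OF \<Gamma>(1)]) (auto intro!: continuous_intros)
    show "(\<lambda>t. \<Gamma> (t / (1 - t))) ` {0..<1} \<subseteq> ball 0 1"
      by (intro image_subsetI ball divide_nonneg_nonneg) auto
    show "((\<lambda>t. norm (\<Gamma> (t / (1 - t)))) \<longlongrightarrow> 1) (at_left 1)"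
      by (rule filterlim_compose[OF lim_\<Gamma> time])
    show "filterlim (\<lambda>t. f (\<Gamma> (t / (1 - t)))) (case None of Some a \<Rightarrow> nhds a | None \<Rightarrow> at_infinity) (at_left 1)"
      using filterlim_compose[OF lim_f time] by simp
  qed
qed

text \<open>The same path serves, because \<open>1 / f z\<close> tends to 0 along it.\<close>

lemma asymptotic_value_reciprocal:
  assumes "asymptotic_value f None"
  shows "asymptotic_value (\<lambda>z. \<alpha> + 1 / f z) (Some \<alpha>)"
proof -
  have "((\<lambda>t. \<alpha> + 1 / h t) \<longlongrightarrow> \<alpha>) F" if "filterlim h at_infinity F" for h and F :: "real filter"
    using tendsto_add[OF tendsto_const tendsto_divide_0[OF tendsto_const that]] by simp
  with assms show ?thesis
    unfolding asymptotic_value_def by fastforce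
qed

theorem corollary2p4:
  fixes r :: "nat \<Rightarrow> real" and f :: "complex \<Rightarrow> complex"
  assumes "radius_seq r"
    and "f \<in> abel_universal_wrt r"
  shows "((\<lambda>z. exp (f z)) \<in> abel_universal \<and>
          (\<exists>g \<in> abel_universal. \<forall>z \<in> ball 0 1. g z \<noteq> 0)) \<and>
         (((\<forall>z \<in> ball 0 1. f z \<noteq> 0) \<longrightarrow>
            (\<forall>\<alpha>::complex. (\<lambda>z. \<alpha> + 1 / f z) \<in> abel_universal)) \<and>
          (\<forall>\<alpha>::complex. \<exists>g \<in> abel_universal_wrt r. asymptotic_value g (Some \<alpha>)))"
proof -
  have universal: "g \<in> abel_universal" if "g \<in> abel_universal_wrt r" for g
    using that assms(1) by (auto simp: abel_universal_def)
  have exp: "(\<lambda>z. exp (f z)) \<in> abel_universal_wrt r"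
    using assms(2) by (rule abel_universal_wrt_exp)
  then have "\<exists>g \<in> abel_universal. \<forall>z \<in> ball 0 1. g z \<noteq> 0"
    using universal by (metis exp_not_eq_zero)
  moreover have "(\<lambda>z. \<alpha> + 1 / f z) \<in> abel_universal" if "\<forall>z \<in> ball 0 1. f z \<noteq> 0" for \<alpha>
    using abel_universal_wrt_reciprocal[OF assms(2)] that by (intro universal) auto
  \<comment> \<open>Passing to \<open>exp (f z)\<close> first ensures zero-freeness while staying
    universal for the same radii \<open>r\<close>, so the reciprocal is universal for
    \<open>r\<close> too.\<close>
  moreover have "\<exists>g \<in> abel_universal_wrt r. asymptotic_value g (Some \<alpha>)" for \<alpha>
  proof
    show "(\<lambda>z. \<alpha> + 1 / exp (f z)) \<in> abel_universal_wrt r"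
      using abel_universal_wrt_reciprocal[OF exp] by simp
    show "asymptotic_value (\<lambda>z. \<alpha> + 1 / exp (f z)) (Some \<alpha>)"
      using abel_universal_wrt_asymptotic_value_infinity[OF assms(1) exp]
      by (rule asymptotic_value_reciprocal)
  qed
  ultimately show ?thesis
    using universal[OF exp] by blast
qed

end
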